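(* Let $T$ be a finite index set, let $\mathbf{L}_t=(L_t,\leq)$ be an irreducible lattice for every $t\in T$, let $\mathbf{L}:=\prod_{t\in T}\mathbf{L}_t$ be the direct product, with underlying set $L=\prod_{t\in T}L_t$, and let $\varphi:L\rightarrow L$ be a mapping. Then $\varphi$ is an automorphism of $\mathbf{L}$ if and only if there exist a permutation $\sigma$ of $T$ and lattice isomorphisms $\varphi_t:L_t\rightarrow L_{\sigma^{-1}(t)}$ for every $t\in T$ such that $$\varphi = (\varphi_{\sigma(t)}\circ \pi_{\sigma(t)})_{t\in T},$$ where $\pi_t:L\to L_t$ is the $t$-th projection; i.e., $\varphi((x_t)_{t\in T}) = (\varphi_{\sigma(t)}(x_{\sigma(t)}))_{t\in T}$ for all $(x_t)_{t\in T}\in L$.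
   Context: A lattice is called trivial if it has exactly one element, otherwise nontrivial. A lattice is called irreducible if it is nontrivial and not isomorphic to a direct product of two nontrivial lattices. Isomorphisms and automorphisms of lattices are order isomorphisms and order automorphisms (equivalently, isomorphisms and automorphisms of lattices as algebras with $\vee,\wedge$). Direct products are ordered componentwise. *)

theory Defs
  imports "HOL-Algebra.Lattice" "HOL-Combinatorics.Permutations"
begin

definition order_iso :: "('a, 'c) gorder_scheme \<Rightarrow> ('b, 'd) gorder_scheme \<Rightarrow> ('a \<Rightarrow> 'b) \<Rightarrow> bool"
  where "order_iso A B f \<longleftrightarrow>
    order_emb A B f \<and> bij_betw f (carrier A) (carrier B)"

abbreviation order_automorphism :: "('a, 'c) gorder_scheme \<Rightarrow> ('a \<Rightarrow> 'a) \<Rightarrow> bool"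
  where "order_automorphism A f \<equiv> order_iso A A f"

definition binary_product :: "'a gorder \<Rightarrow> 'b gorder \<Rightarrow> ('a \<times> 'b) gorder"
  where "binary_product A B =
    \<lparr>carrier = carrier A \<times> carrier B,
     eq = (=),
     le = (\<lambda>x y. fst x \<sqsubseteq>\<^bsub>A\<^esub> fst y \<and> snd x \<sqsubseteq>\<^bsub>B\<^esub> snd y)\<rparr>"

definition direct_product :: "'t set \<Rightarrow> ('t \<Rightarrow> 'a gorder) \<Rightarrow> ('t \<Rightarrow> 'a) gorder"
  where "direct_product T L =
    \<lparr>carrier = (\<Pi>\<^sub>E t\<in>T. carrier (L t)),
     eq = (=),
     le = (\<lambda>x y. \<forall>t\<in>T. x t \<sqsubseteq>\<^bsub>L t\<^esub> y t)\<rparr>"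

text \<open>
  The locale \<^locale>\<open>lattice\<close> admits an empty carrier, whereas lattices are meant to be
  nonempty here. Nonemptiness is therefore required explicitly; without it the empty lattice
  would count as nontrivial.
\<close>

definition nontrivial_lattice :: "'a gorder \<Rightarrow> bool"
  where "nontrivial_lattice K \<longleftrightarrow>
    lattice K \<and> carrier K \<noteq> {} \<and> \<not> (\<exists>x. carrier K = {x})"

text \<open>
  The factors \<open>A\<close> and \<open>B\<close> range over lattices on the element type of \<open>K\<close>. This is no
  restriction, since both factors of a decomposition embed into \<open>K\<close>; see
  \<open>irreducible_lattice_any_type\<close> below.
\<close>

definition irreducible_lattice :: "'a gorder \<Rightarrow> bool"
  where "irreducible_lattice K \<longleftrightarrow>
    nontrivial_lattice K \<and>
    \<not> (\<exists>(A :: 'a gorder) (B :: 'a gorder) f.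
          nontrivial_lattice A \<and> nontrivial_lattice B \<and> order_iso K (binary_product A B) f)"

lemma nontrivial_lattice_transfer:
  fixes A :: "'b gorder" and i :: "'b \<Rightarrow> 'a"
  assumes A: "nontrivial_lattice A" and i: "inj_on i (carrier A)"
    and le: "\<And>x y. x \<in> carrier A \<Longrightarrow> y \<in> carrier A \<Longrightarrow> r (i x) (i y) \<longleftrightarrow> x \<sqsubseteq>\<^bsub>A\<^esub> y"
  shows "nontrivial_lattice \<lparr>carrier = i ` carrier A, eq = (=), le = r\<rparr>" (is "nontrivial_lattice ?A'")
proof -
  interpret A: lattice A using A by (simp add: nontrivial_lattice_def)
  have up: "least ?A' (i s) (Upper ?A' {i x, i y})"
    if "x \<in> carrier A" "y \<in> carrier A" "least A s (Upper A {x, y})" for x y s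
    using that le by (auto simp: least_def Upper_def)
  have lo: "greatest ?A' (i s) (Lower ?A' {i x, i y})"
    if "x \<in> carrier A" "y \<in> carrier A" "greatest A s (Lower A {x, y})" for x y s
    using that le by (auto simp: greatest_def Lower_def)
  have "lattice ?A'"
  proof unfold_locales
    fix x y assume "x \<in> carrier ?A'" "y \<in> carrier ?A'"
    then obtain a b where ab: "a \<in> carrier A" "b \<in> carrier A" "x = i a" "y = i b" by auto
    from A.sup_of_two_exists[OF ab(1,2)] ab up show "\<exists>s. least ?A' s (Upper ?A' {x, y})" by blast
    from A.inf_of_two_exists[OF ab(1,2)] ab lo show "\<exists>s. greatest ?A' s (Lower ?A' {x, y})" by blast
  next
    fix x y assume "x \<sqsubseteq>\<^bsub>?A'\<^esub> y" "y \<sqsubseteq>\<^bsub>?A'\<^esub> x" "x \<in> carrier ?A'" "y \<in> carrier ?A'"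
    then show "x .=\<^bsub>?A'\<^esub> y" using le by (auto dest: A.le_antisym)
  next
    fix x y z assume "x \<sqsubseteq>\<^bsub>?A'\<^esub> y" "y \<sqsubseteq>\<^bsub>?A'\<^esub> z" "x \<in> carrier ?A'" "y \<in> carrier ?A'" "z \<in> carrier ?A'"
    then show "x \<sqsubseteq>\<^bsub>?A'\<^esub> z" using le by (auto intro: A.le_trans)
  qed (use le in auto)
  moreover have "carrier ?A' \<noteq> {} \<and> \<not> (\<exists>x. carrier ?A' = {x})"
  proof -
    obtain x where x: "x \<in> carrier A" using A by (auto simp: nontrivial_lattice_def)
    moreover obtain y where "y \<in> carrier A" "y \<noteq> x"
      using A x by (auto simp: nontrivial_lattice_def)
    ultimately have "i x \<in> carrier ?A'" "i y \<in> carrier ?A'" "i x \<noteq> i y"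
      using i by (auto dest: inj_onD)
    then show ?thesis by (metis empty_iff singletonD)
  qed
  ultimately show ?thesis by (simp add: nontrivial_lattice_def)
qed

lemma weak_partial_order_binary_product:
  assumes "partial_order A" "partial_order B"
  shows "weak_partial_order (binary_product A B)"
proof -
  interpret A: partial_order A by fact
  interpret B: partial_order B by fact
  show ?thesis
    by unfold_locales
      (auto simp: binary_product_def dest: A.le_antisym B.le_antisym A.le_trans B.le_trans)
qed

lemma irreducible_lattice_any_type:
  fixes K :: "'a gorder" and A :: "'b gorder" and B :: "'c gorder"
  assumes K: "irreducible_lattice K" and A: "nontrivial_lattice A" and B: "nontrivial_lattice B"
  shows "\<not> order_iso K (binary_product A B) f"
proof
  assume f: "order_iso K (binary_product A B) f"
  interpret A: lattice A using A by (simp add: nontrivial_lattice_def)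
  interpret B: lattice B using B by (simp add: nontrivial_lattice_def)
  obtain a0 b0 where a0: "a0 \<in> carrier A" and b0: "b0 \<in> carrier B"
    using A B by (auto simp: nontrivial_lattice_def)
  define g where "g = inv_into (carrier K) f"
  have bij: "bij_betw f (carrier K) (carrier A \<times> carrier B)"
    using f by (simp add: order_iso_def order_emb_def binary_product_def)
  then have g: "g p \<in> carrier K" "f (g p) = p" if "p \<in> carrier A \<times> carrier B" for p
    using that bij_betw_inv_into_right[OF bij] bij_betwE[OF bij_betw_inv_into[OF bij]]
    by (auto simp: g_def)
  have le: "x \<sqsubseteq>\<^bsub>K\<^esub> y \<longleftrightarrow> fst (f x) \<sqsubseteq>\<^bsub>A\<^esub> fst (f y) \<and> snd (f x) \<sqsubseteq>\<^bsub>B\<^esub> snd (f y)"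
    if "x \<in> carrier K" "y \<in> carrier K" for x y
    using f that by (simp add: order_iso_def order_emb_def binary_product_def)
  define i where "i a = g (a, b0)" for a
  define j where "j b = g (a0, b)" for b
  have i: "inj_on i (carrier A)"
    by (rule inj_onI) (metis i_def g(2) b0 SigmaI Pair_inject)
  have j: "inj_on j (carrier B)"
    by (rule inj_onI) (metis j_def g(2) a0 SigmaI Pair_inject)
  have ile: "i x \<sqsubseteq>\<^bsub>K\<^esub> i y \<longleftrightarrow> x \<sqsubseteq>\<^bsub>A\<^esub> y" if "x \<in> carrier A" "y \<in> carrier A" for x y
    using that b0 by (simp add: i_def le g)
  have jle: "j x \<sqsubseteq>\<^bsub>K\<^esub> j y \<longleftrightarrow> x \<sqsubseteq>\<^bsub>B\<^esub> y" if "x \<in> carrier B" "y \<in> carrier B" for x y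
    using that a0 by (simp add: j_def le g)
  define A' where "A' = (\<lparr>carrier = i ` carrier A, eq = (=), le = le K\<rparr> :: 'a gorder)"
  define B' where "B' = (\<lparr>carrier = j ` carrier B, eq = (=), le = le K\<rparr> :: 'a gorder)"
  have AB: "nontrivial_lattice A'" "nontrivial_lattice B'"
    unfolding A'_def B'_def
    using nontrivial_lattice_transfer[OF A i, of "le K"] nontrivial_lattice_transfer[OF B j, of "le K"]
      ile jle by auto
  have wp: "weak_partial_order (binary_product A' B')"
    using AB by (intro weak_partial_order_binary_product) (auto simp: nontrivial_lattice_def lattice_def upper_semilattice_def)
  have wK: "weak_partial_order K"
    using f by (simp add: order_iso_def order_emb_def)
  have "order_iso K (binary_product A' B') (map_prod i j \<circ> f)"
  proof -
    have "bij_betw (map_prod i j) (carrier A \<times> carrier B) (carrier A' \<times> carrier B')"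
      using i j by (auto simp: A'_def B'_def intro!: bij_betw_map_prod inj_on_imp_bij_betw)
    then have "bij_betw (map_prod i j \<circ> f) (carrier K) (carrier A' \<times> carrier B')"
      using bij by (rule bij_betw_trans[rotated])
    moreover have "f x \<in> carrier A \<times> carrier B" if "x \<in> carrier K" for x
      using that bij bij_betwE by blast
    ultimately show ?thesis
      using ile jle le wp wK
      by (auto simp: order_iso_def order_emb_def binary_product_def A'_def B'_def mem_Times_iff)
  qed
  with AB show False using K unfolding irreducible_lattice_def by blast
qed

end

theory Submission
  imports Defs
begin

text \<open>
  Kernels of homomorphisms from a product of lattices are compatible with the product
  decomposition, because lattices have a majority term. Hence, for a surjective homomorphism \<open>q\<close>
  from the product onto a lattice \<open>K\<close> and a set \<open>S\<close> of coordinates, \<open>K\<close> is isomorphic to the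
  product of the images under \<open>q\<close> of the slice in which only the coordinates in \<open>S\<close> vary
  and of the complementary slice. If \<open>K\<close> is irreducible, one of the two images is a
  singleton, and so \<open>q\<close> depends on a single coordinate. Applying this to the components of \<open>\<phi>\<close>
  and of its inverse yields the permutation and the isomorphisms between the factors.
\<close>

section \<open>Joins, meets and sublattices in terms of the order\<close>

lemma (in upper_semilattice) join_eqI:
  assumes "s \<in> carrier L" "x \<in> carrier L" "y \<in> carrier L" "x \<sqsubseteq> s" "y \<sqsubseteq> s"
    and "\<And>u. u \<in> carrier L \<Longrightarrow> x \<sqsubseteq> u \<Longrightarrow> y \<sqsubseteq> u \<Longrightarrow> s \<sqsubseteq> u"
  shows "x \<squnion> y = s"
proof (rule le_antisym)
  show "x \<squnion> y \<sqsubseteq> s" using assms(4,5,2,3,1) by (rule join_le)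
  show "s \<sqsubseteq> x \<squnion> y" using assms(2,3) by (intro assms(6) join_closed join_left join_right)
qed (use assms in simp_all)

lemma (in lower_semilattice) meet_eqI:
  assumes "i \<in> carrier L" "x \<in> carrier L" "y \<in> carrier L" "i \<sqsubseteq> x" "i \<sqsubseteq> y"
    and "\<And>u. u \<in> carrier L \<Longrightarrow> u \<sqsubseteq> x \<Longrightarrow> u \<sqsubseteq> y \<Longrightarrow> u \<sqsubseteq> i"
  shows "x \<sqinter> y = i"
proof (rule le_antisym)
  show "i \<sqsubseteq> x \<sqinter> y" using assms(4,5,2,3,1) by (rule meet_le)
  show "x \<sqinter> y \<sqsubseteq> i" using assms(2,3) by (intro assms(6) meet_closed meet_left meet_right)
qed (use assms in simp_all)

text \<open>Replaces \<open>Upper\<close> and \<open>Lower\<close> by elementwise bounds, the form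
  in which sublattices and products are checked below.\<close>

lemma latticeI:
  fixes K :: "'a gorder"
  assumes "partial_order K"
    and j: "\<And>x y. x \<in> carrier K \<Longrightarrow> y \<in> carrier K \<Longrightarrow>
      \<exists>s\<in>carrier K. x \<sqsubseteq>\<^bsub>K\<^esub> s \<and> y \<sqsubseteq>\<^bsub>K\<^esub> s \<and> (\<forall>u\<in>carrier K. x \<sqsubseteq>\<^bsub>K\<^esub> u \<longrightarrow> y \<sqsubseteq>\<^bsub>K\<^esub> u \<longrightarrow> s \<sqsubseteq>\<^bsub>K\<^esub> u)"
    and m: "\<And>x y. x \<in> carrier K \<Longrightarrow> y \<in> carrier K \<Longrightarrow>
      \<exists>s\<in>carrier K. s \<sqsubseteq>\<^bsub>K\<^esub> x \<and> s \<sqsubseteq>\<^bsub>K\<^esub> y \<and> (\<forall>u\<in>carrier K. u \<sqsubseteq>\<^bsub>K\<^esub> x \<longrightarrow> u \<sqsubseteq>\<^bsub>K\<^esub> y \<longrightarrow> u \<sqsubseteq>\<^bsub>K\<^esub> s)"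
  shows "lattice K"
proof -
  interpret partial_order K by fact
  show ?thesis
  proof
    fix x y assume xy: "x \<in> carrier K" "y \<in> carrier K"
    obtain s where "s \<in> carrier K" "x \<sqsubseteq>\<^bsub>K\<^esub> s" "y \<sqsubseteq>\<^bsub>K\<^esub> s"
      "\<forall>u\<in>carrier K. x \<sqsubseteq>\<^bsub>K\<^esub> u \<longrightarrow> y \<sqsubseteq>\<^bsub>K\<^esub> u \<longrightarrow> s \<sqsubseteq>\<^bsub>K\<^esub> u"
      using j[OF xy] by blast
    then have "least K s (Upper K {x, y})"
      using xy by (simp add: least_def Upper_def)
    then show "\<exists>s. least K s (Upper K {x, y})" ..
  next
    fix x y assume xy: "x \<in> carrier K" "y \<in> carrier K"
    obtain i where "i \<in> carrier K" "i \<sqsubseteq>\<^bsub>K\<^esub> x" "i \<sqsubseteq>\<^bsub>K\<^esub> y"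
      "\<forall>u\<in>carrier K. u \<sqsubseteq>\<^bsub>K\<^esub> x \<longrightarrow> u \<sqsubseteq>\<^bsub>K\<^esub> y \<longrightarrow> u \<sqsubseteq>\<^bsub>K\<^esub> i"
      using m[OF xy] by blast
    then have "greatest K i (Lower K {x, y})"
      using xy by (simp add: greatest_def Lower_def)
    then show "\<exists>i. greatest K i (Lower K {x, y})" ..
  qed
qed

text \<open>Closure puts the ambient join and meet into \<open>H\<close>, and a bound that is
  optimal in the ambient lattice is optimal among the bounds in \<open>H\<close>.\<close>

lemma (in lattice) sublattice:
  assumes "H \<subseteq> carrier L"
    and "\<And>x y. x \<in> H \<Longrightarrow> y \<in> H \<Longrightarrow> x \<squnion> y \<in> H"
    and "\<And>x y. x \<in> H \<Longrightarrow> y \<in> H \<Longrightarrow> x \<sqinter> y \<in> H"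
  shows "lattice \<lparr>carrier = H, eq = (=), le = le L\<rparr>" (is "lattice ?H")
proof (rule latticeI)
  show "partial_order ?H"
  proof
    fix x y z
    assume "x \<sqsubseteq>\<^bsub>?H\<^esub> y" "y \<sqsubseteq>\<^bsub>?H\<^esub> z" "x \<in> carrier ?H" "y \<in> carrier ?H" "z \<in> carrier ?H"
    then show "x \<sqsubseteq>\<^bsub>?H\<^esub> z" using le_trans[of x y z] assms(1) by auto
  next
    fix x y
    assume "x \<sqsubseteq>\<^bsub>?H\<^esub> y" "y \<sqsubseteq>\<^bsub>?H\<^esub> x" "x \<in> carrier ?H" "y \<in> carrier ?H"
    then show "x .=\<^bsub>?H\<^esub> y" using le_antisym[of x y] assms(1) by auto
  qed (use assms(1) in auto)
next
  fix x y assume xy: "x \<in> carrier ?H" "y \<in> carrier ?H"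
  then have xy': "x \<in> carrier L" "y \<in> carrier L" using assms(1) by auto
  show "\<exists>s\<in>carrier ?H. x \<sqsubseteq>\<^bsub>?H\<^esub> s \<and> y \<sqsubseteq>\<^bsub>?H\<^esub> s \<and>
      (\<forall>u\<in>carrier ?H. x \<sqsubseteq>\<^bsub>?H\<^esub> u \<longrightarrow> y \<sqsubseteq>\<^bsub>?H\<^esub> u \<longrightarrow> s \<sqsubseteq>\<^bsub>?H\<^esub> u)"
    by (rule bexI[of _ "x \<squnion> y"])
      (use xy xy' assms(1) assms(2)[of x y] in \<open>auto simp: join_left join_right intro!: join_le\<close>)
  show "\<exists>s\<in>carrier ?H. s \<sqsubseteq>\<^bsub>?H\<^esub> x \<and> s \<sqsubseteq>\<^bsub>?H\<^esub> y \<and>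
      (\<forall>u\<in>carrier ?H. u \<sqsubseteq>\<^bsub>?H\<^esub> x \<longrightarrow> u \<sqsubseteq>\<^bsub>?H\<^esub> y \<longrightarrow> u \<sqsubseteq>\<^bsub>?H\<^esub> s)"
    by (rule bexI[of _ "x \<sqinter> y"])
      (use xy xy' assms(1) assms(3)[of x y] in \<open>auto simp: meet_left meet_right intro!: meet_le\<close>)
qed

section \<open>The majority term and surjective homomorphisms\<close>

definition median :: "('a, 'b) gorder_scheme \<Rightarrow> 'a \<Rightarrow> 'a \<Rightarrow> 'a \<Rightarrow> 'a"
  where "median K x y z = (x \<sqinter>\<^bsub>K\<^esub> y) \<squnion>\<^bsub>K\<^esub> (y \<sqinter>\<^bsub>K\<^esub> z) \<squnion>\<^bsub>K\<^esub> (z \<sqinter>\<^bsub>K\<^esub> x)"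

text \<open>One of the three meets is \<open>x\<close> by idempotence and the other two are the meet
  of \<open>x\<close> and \<open>y\<close>, which absorption removes.\<close>

lemma (in lattice) median_majority:
  assumes "x \<in> carrier L" "y \<in> carrier L"
  shows "median L x x y = x" "median L x y x = x" "median L y x x = x"
proof -
  have xx: "x \<sqinter> x = x"
    using assms by (intro meet_eqI) auto
  have "x \<sqinter> y \<sqsubseteq> x" "x \<sqinter> y \<in> carrier L"
    using assms by (auto simp: meet_left)
  then have "x \<squnion> (x \<sqinter> y) = x" "(x \<sqinter> y) \<squnion> x = x" "(x \<sqinter> y) \<squnion> (x \<sqinter> y) = x \<sqinter> y"
    using assms by (auto intro!: join_eqI)
  then show "median L x x y = x" "median L x y x = x" "median L y x x = x"
    unfolding median_def meet_comm[of L y x] xx by simp_all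
qed

definition surj_lattice_hom :: "('a, 'c) gorder_scheme \<Rightarrow> ('b, 'd) gorder_scheme \<Rightarrow> ('a \<Rightarrow> 'b) \<Rightarrow> bool"
  where "surj_lattice_hom A B f \<longleftrightarrow> f ` carrier A = carrier B \<and>
    (\<forall>x\<in>carrier A. \<forall>y\<in>carrier A.
      f (x \<squnion>\<^bsub>A\<^esub> y) = f x \<squnion>\<^bsub>B\<^esub> f y \<and> f (x \<sqinter>\<^bsub>A\<^esub> y) = f x \<sqinter>\<^bsub>B\<^esub> f y)"

lemma surj_lattice_hom_comp:
  assumes f: "surj_lattice_hom A B f" and g: "surj_lattice_hom B C g"
  shows "surj_lattice_hom A C (g \<circ> f)"
proof -
  have "f x \<in> carrier B" if "x \<in> carrier A" for x
    using f that by (auto simp: surj_lattice_hom_def)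
  moreover have "(g \<circ> f) ` carrier A = carrier C"
    using f g by (simp add: surj_lattice_hom_def flip: image_image)
  ultimately show ?thesis
    using f g by (simp add: surj_lattice_hom_def)
qed

lemma order_iso_inv:
  assumes "order_iso A B f"
  shows "order_iso B A (inv_into (carrier A) f)"
proof -
  have bij: "bij_betw f (carrier A) (carrier B)" using assms by (simp add: order_iso_def)
  note inv = bij_betw_inv_into[OF bij]
  show ?thesis
    using assms inv bij_betwE[OF inv] bij_betw_inv_into_right[OF bij]
    unfolding order_iso_def order_emb_def by metis
qed

text \<open>The image of a join is the least upper bound in \<open>B\<close>, because by
  surjectivity every competing bound is the image of a bound in \<open>A\<close>; dually for
  meets.\<close>

lemma surj_lattice_hom_order_iso:
  assumes "lattice A" "lattice B" and f: "order_iso A B f"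
  shows "surj_lattice_hom A B f"
proof -
  interpret A: lattice A by fact
  interpret B: lattice B by fact
  have img: "f ` carrier A = carrier B"
    using f by (simp add: order_iso_def bij_betw_def)
  then have carr: "f x \<in> carrier B" if "x \<in> carrier A" for x
    using that by auto
  have le: "f x \<sqsubseteq>\<^bsub>B\<^esub> f y \<longleftrightarrow> x \<sqsubseteq>\<^bsub>A\<^esub> y" if "x \<in> carrier A" "y \<in> carrier A" for x y
    using f that by (simp add: order_iso_def order_emb_def)
  have "f x \<squnion>\<^bsub>B\<^esub> f y = f (x \<squnion>\<^bsub>A\<^esub> y)" if "x \<in> carrier A" "y \<in> carrier A" for x y
    using that by (intro B.join_eqI)
      (auto simp: carr le A.join_left A.join_right A.join_le img[symmetric])
  moreover have "f x \<sqinter>\<^bsub>B\<^esub> f y = f (x \<sqinter>\<^bsub>A\<^esub> y)" if "x \<in> carrier A" "y \<in> carrier A" for x y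
    using that by (intro B.meet_eqI)
      (auto simp: carr le A.meet_left A.meet_right A.meet_le img[symmetric])
  ultimately show ?thesis
    by (simp add: surj_lattice_hom_def img)
qed

lemma surj_lattice_hom_median:
  assumes "lattice A" and "surj_lattice_hom A B q"
    and "x \<in> carrier A" "y \<in> carrier A" "z \<in> carrier A"
  shows "q (median A x y z) = median B (q x) (q y) (q z)"
proof -
  interpret A: lattice A by fact
  show ?thesis using assms(2-) by (simp add: surj_lattice_hom_def median_def)
qed

section \<open>Dependence on coordinates, and the product as a lattice\<close>

text \<open>Equivalently, \<open>q\<close> factors on \<open>X\<close> through restriction to
  \<open>S\<close>. A complement \<open>- S\<close> in the whole type may serve as coordinate set,
  since all tuples of the product agree outside \<open>T\<close>, where they are
  \<open>undefined\<close>.\<close>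

definition determined_by :: "('t \<Rightarrow> 'a) set \<Rightarrow> 't set \<Rightarrow> (('t \<Rightarrow> 'a) \<Rightarrow> 'b) \<Rightarrow> bool"
  where "determined_by X S q \<longleftrightarrow> (\<forall>x\<in>X. \<forall>y\<in>X. (\<forall>t\<in>S. x t = y t) \<longrightarrow> q x = q y)"

lemma determined_byD:
  "determined_by X S q \<Longrightarrow> x \<in> X \<Longrightarrow> y \<in> X \<Longrightarrow> (\<And>t. t \<in> S \<Longrightarrow> x t = y t) \<Longrightarrow> q x = q y"
  unfolding determined_by_def by blast

locale lattice_family =
  fixes T :: "'t set" and L :: "'t \<Rightarrow> 'a gorder"
  assumes lattice_factor: "t \<in> T \<Longrightarrow> lattice (L t)"
begin

abbreviation P :: "('t \<Rightarrow> 'a) gorder" where "P \<equiv> direct_product T L"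

lemma carrier_P: "carrier P = (\<Pi>\<^sub>E t\<in>T. carrier (L t))"
  and le_P: "x \<sqsubseteq>\<^bsub>P\<^esub> y \<longleftrightarrow> (\<forall>t\<in>T. x t \<sqsubseteq>\<^bsub>L t\<^esub> y t)"
  and eq_P: "x .=\<^bsub>P\<^esub> y \<longleftrightarrow> x = y"
  by (simp_all add: direct_product_def)

lemma P_component: "x \<in> carrier P \<Longrightarrow> t \<in> T \<Longrightarrow> x t \<in> carrier (L t)"
  by (auto simp: carrier_P)

lemma P_eqI:
  "x \<in> carrier P \<Longrightarrow> y \<in> carrier P \<Longrightarrow> (\<And>t. t \<in> T \<Longrightarrow> x t = y t) \<Longrightarrow> x = y"
  unfolding carrier_P by (rule PiE_ext)

lemma restrict_in_P:
  "(\<And>t. t \<in> T \<Longrightarrow> f t \<in> carrier (L t)) \<Longrightarrow> (\<lambda>t\<in>T. f t) \<in> carrier P"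
  by (auto simp: carrier_P)

text \<open>The recombination of coordinates used throughout: values of \<open>y\<close> on
  \<open>S\<close>, of \<open>x\<close> elsewhere.\<close>

lemma override_on_P:
  "x \<in> carrier P \<Longrightarrow> y \<in> carrier P \<Longrightarrow> override_on x y S \<in> carrier P"
  by (auto simp: carrier_P override_on_def PiE_iff extensional_def)

lemma partial_order_P: "partial_order P"
proof
  fix x y assume xy: "x \<sqsubseteq>\<^bsub>P\<^esub> y" "y \<sqsubseteq>\<^bsub>P\<^esub> x" "x \<in> carrier P" "y \<in> carrier P"
  have "x t = y t" if t: "t \<in> T" for t
  proof -
    interpret lattice "L t" using t by (rule lattice_factor)
    show ?thesis using xy t by (intro le_antisym) (auto simp: le_P P_component)
  qed
  with xy show "x .=\<^bsub>P\<^esub> y" by (auto simp: eq_P intro: P_eqI)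
next
  fix x y z assume xyz: "x \<sqsubseteq>\<^bsub>P\<^esub> y" "y \<sqsubseteq>\<^bsub>P\<^esub> z" "x \<in> carrier P" "y \<in> carrier P" "z \<in> carrier P"
  show "x \<sqsubseteq>\<^bsub>P\<^esub> z"
    unfolding le_P
  proof
    fix t assume t: "t \<in> T"
    interpret lattice "L t" using t by (rule lattice_factor)
    show "x t \<sqsubseteq>\<^bsub>L t\<^esub> z t" using xyz t by (auto simp: le_P P_component intro: le_trans[of _ "y t"])
  qed
next
  fix x assume x: "x \<in> carrier P"
  show "x \<sqsubseteq>\<^bsub>P\<^esub> x"
    unfolding le_P
  proof
    fix t assume t: "t \<in> T"
    interpret lattice "L t" using t by (rule lattice_factor)
    show "x t \<sqsubseteq>\<^bsub>L t\<^esub> x t" using x t by (simp add: P_component)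
  qed
qed (simp_all add: direct_product_def)

text \<open>Makes the join laws of all factors available at once, without interpreting
  \<open>L t\<close> for each \<open>t\<close>.\<close>

lemma factor_join:
  assumes "t \<in> T" "x \<in> carrier P" "y \<in> carrier P"
  shows "x t \<squnion>\<^bsub>L t\<^esub> y t \<in> carrier (L t)"
    "x t \<sqsubseteq>\<^bsub>L t\<^esub> x t \<squnion>\<^bsub>L t\<^esub> y t" "y t \<sqsubseteq>\<^bsub>L t\<^esub> x t \<squnion>\<^bsub>L t\<^esub> y t"
    "\<And>u. u \<in> carrier P \<Longrightarrow> x t \<sqsubseteq>\<^bsub>L t\<^esub> u t \<Longrightarrow> y t \<sqsubseteq>\<^bsub>L t\<^esub> u t \<Longrightarrow> x t \<squnion>\<^bsub>L t\<^esub> y t \<sqsubseteq>\<^bsub>L t\<^esub> u t"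
proof -
  interpret lattice "L t" using assms(1) by (rule lattice_factor)
  show "x t \<squnion>\<^bsub>L t\<^esub> y t \<in> carrier (L t)"
    "x t \<sqsubseteq>\<^bsub>L t\<^esub> x t \<squnion>\<^bsub>L t\<^esub> y t" "y t \<sqsubseteq>\<^bsub>L t\<^esub> x t \<squnion>\<^bsub>L t\<^esub> y t"
    "\<And>u. u \<in> carrier P \<Longrightarrow> x t \<sqsubseteq>\<^bsub>L t\<^esub> u t \<Longrightarrow> y t \<sqsubseteq>\<^bsub>L t\<^esub> u t \<Longrightarrow> x t \<squnion>\<^bsub>L t\<^esub> y t \<sqsubseteq>\<^bsub>L t\<^esub> u t"
    using assms by (simp_all add: P_component join_left join_right join_le)
qed

lemma factor_meet:
  assumes "t \<in> T" "x \<in> carrier P" "y \<in> carrier P"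
  shows "x t \<sqinter>\<^bsub>L t\<^esub> y t \<in> carrier (L t)"
    "x t \<sqinter>\<^bsub>L t\<^esub> y t \<sqsubseteq>\<^bsub>L t\<^esub> x t" "x t \<sqinter>\<^bsub>L t\<^esub> y t \<sqsubseteq>\<^bsub>L t\<^esub> y t"
    "\<And>u. u \<in> carrier P \<Longrightarrow> u t \<sqsubseteq>\<^bsub>L t\<^esub> x t \<Longrightarrow> u t \<sqsubseteq>\<^bsub>L t\<^esub> y t \<Longrightarrow> u t \<sqsubseteq>\<^bsub>L t\<^esub> x t \<sqinter>\<^bsub>L t\<^esub> y t"
proof -
  interpret lattice "L t" using assms(1) by (rule lattice_factor)
  show "x t \<sqinter>\<^bsub>L t\<^esub> y t \<in> carrier (L t)"
    "x t \<sqinter>\<^bsub>L t\<^esub> y t \<sqsubseteq>\<^bsub>L t\<^esub> x t" "x t \<sqinter>\<^bsub>L t\<^esub> y t \<sqsubseteq>\<^bsub>L t\<^esub> y t"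
    "\<And>u. u \<in> carrier P \<Longrightarrow> u t \<sqsubseteq>\<^bsub>L t\<^esub> x t \<Longrightarrow> u t \<sqsubseteq>\<^bsub>L t\<^esub> y t \<Longrightarrow> u t \<sqsubseteq>\<^bsub>L t\<^esub> x t \<sqinter>\<^bsub>L t\<^esub> y t"
    using assms by (simp_all add: P_component meet_left meet_right meet_le)
qed

lemma lattice_P: "lattice P"
proof (rule latticeI[OF partial_order_P])
  fix x y assume xy: "x \<in> carrier P" "y \<in> carrier P"
  show "\<exists>s\<in>carrier P. x \<sqsubseteq>\<^bsub>P\<^esub> s \<and> y \<sqsubseteq>\<^bsub>P\<^esub> s \<and>
      (\<forall>u\<in>carrier P. x \<sqsubseteq>\<^bsub>P\<^esub> u \<longrightarrow> y \<sqsubseteq>\<^bsub>P\<^esub> u \<longrightarrow> s \<sqsubseteq>\<^bsub>P\<^esub> u)"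
    by (rule bexI[of _ "\<lambda>t\<in>T. x t \<squnion>\<^bsub>L t\<^esub> y t"])
      (use xy in \<open>auto simp: le_P factor_join intro!: restrict_in_P\<close>)
  show "\<exists>s\<in>carrier P. s \<sqsubseteq>\<^bsub>P\<^esub> x \<and> s \<sqsubseteq>\<^bsub>P\<^esub> y \<and>
      (\<forall>u\<in>carrier P. u \<sqsubseteq>\<^bsub>P\<^esub> x \<longrightarrow> u \<sqsubseteq>\<^bsub>P\<^esub> y \<longrightarrow> u \<sqsubseteq>\<^bsub>P\<^esub> s)"
    by (rule bexI[of _ "\<lambda>t\<in>T. x t \<sqinter>\<^bsub>L t\<^esub> y t"])
      (use xy in \<open>auto simp: le_P factor_meet intro!: restrict_in_P\<close>)
qed

sublocale P: lattice P by (rule lattice_P)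

lemma join_P:
  assumes "x \<in> carrier P" "y \<in> carrier P"
  shows "x \<squnion>\<^bsub>P\<^esub> y = (\<lambda>t\<in>T. x t \<squnion>\<^bsub>L t\<^esub> y t)"
  using assms by (intro P.join_eqI) (auto simp: le_P factor_join intro!: restrict_in_P)

lemma meet_P:
  assumes "x \<in> carrier P" "y \<in> carrier P"
  shows "x \<sqinter>\<^bsub>P\<^esub> y = (\<lambda>t\<in>T. x t \<sqinter>\<^bsub>L t\<^esub> y t)"
  using assms by (intro P.meet_eqI) (auto simp: le_P factor_meet intro!: restrict_in_P)

lemma median_in_P:
  "x \<in> carrier P \<Longrightarrow> y \<in> carrier P \<Longrightarrow> z \<in> carrier P \<Longrightarrow> median P x y z \<in> carrier P"
  by (simp add: median_def)

lemma median_P: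
  assumes "x \<in> carrier P" "y \<in> carrier P" "z \<in> carrier P" "t \<in> T"
  shows "median P x y z t = median (L t) (x t) (y t) (z t)"
proof -
  have "x \<sqinter>\<^bsub>P\<^esub> y \<in> carrier P" "y \<sqinter>\<^bsub>P\<^esub> z \<in> carrier P" "z \<sqinter>\<^bsub>P\<^esub> x \<in> carrier P"
    "(x \<sqinter>\<^bsub>P\<^esub> y) \<squnion>\<^bsub>P\<^esub> (y \<sqinter>\<^bsub>P\<^esub> z) \<in> carrier P"
    using assms by simp_all
  then show ?thesis
    using assms(4) unfolding median_def
    by (simp only: join_P) (simp add: meet_P assms)
qed

section \<open>Kernels of homomorphisms and coordinate slices\<close>

text \<open>Any tuple of the nonempty product can be changed at \<open>t\<close> to a prescribed
  value, which gives surjectivity.\<close>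

lemma surj_lattice_hom_component:
  assumes t: "t \<in> T" and ne: "carrier P \<noteq> {}"
  shows "surj_lattice_hom P (L t) (\<lambda>x. x t)"
proof -
  have "a \<in> (\<lambda>x. x t) ` carrier P" if "a \<in> carrier (L t)" for a
  proof -
    obtain b where "b \<in> carrier P" using ne by auto
    then have "b(t := a) \<in> carrier P"
      using that t by (auto simp: carrier_P PiE_iff extensional_def)
    then show ?thesis by (rule rev_image_eqI) simp
  qed
  then show ?thesis
    using t by (auto simp: surj_lattice_hom_def P_component join_P meet_P)
qed

text \<open>
  Both overridden tuples are medians of \<open>x\<close> resp.\ \<open>y\<close> with the same two elements,
  the overridden tuples themselves.
\<close>

lemma override_on_eq:
  assumes q: "surj_lattice_hom P K q"
    and carr: "x \<in> carrier P" "y \<in> carrier P" "z \<in> carrier P" and eq: "q x = q y"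
  shows "q (override_on z x S) = q (override_on z y S)" (is "q ?u = q ?v")
proof -
  have uv: "?u \<in> carrier P" "?v \<in> carrier P"
    using carr by (simp_all add: override_on_P)
  \<comment> \<open>On \<open>S\<close>, \<open>x\<close> agrees with \<open>?u\<close> and
    \<open>y\<close> with \<open>?v\<close>; off \<open>S\<close>, \<open>?u\<close> and
    \<open>?v\<close> both agree with \<open>z\<close>. So two of the three arguments always
    coincide.\<close>
  have "median P x ?u ?v t = ?u t \<and> median P y ?u ?v t = ?v t" if t: "t \<in> T" for t
  proof -
    interpret lattice "L t" using t by (rule lattice_factor)
    show ?thesis
      using carr t uv by (cases "t \<in> S") (simp_all add: median_P P_component median_majority)
  qed
  then have "median P x ?u ?v = ?u" "median P y ?u ?v = ?v"
    using carr uv by (auto intro!: P_eqI median_in_P)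
  then show ?thesis
    using surj_lattice_hom_median[OF lattice_P q] carr uv eq by metis
qed

text \<open>The inequality is turned into an equation: \<open>q\<close> identifies \<open>x\<close>
  with the meet of \<open>x\<close> and \<open>y\<close>. Then \<open>override_on_eq\<close> applies
  to this pair, and overriding \<open>z\<close> commutes with meets.\<close>

lemma override_on_mono:
  assumes K: "lattice K" and q: "surj_lattice_hom P K q"
    and carr: "x \<in> carrier P" "y \<in> carrier P" "z \<in> carrier P" and le: "q x \<sqsubseteq>\<^bsub>K\<^esub> q y"
  shows "q (override_on z x S) \<sqsubseteq>\<^bsub>K\<^esub> q (override_on z y S)" (is "q ?u \<sqsubseteq>\<^bsub>K\<^esub> q ?v")
proof -
  interpret K: lattice K by fact
  have qK: "q w \<in> carrier K" if "w \<in> carrier P" for w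
    using q that by (auto simp: surj_lattice_hom_def)
  have uv: "?u \<in> carrier P" "?v \<in> carrier P"
    using carr by (simp_all add: override_on_P)
  \<comment> \<open>Despite its name, \<open>le_iff_join\<close> characterises the order by a
    meet.\<close>
  have "q (x \<sqinter>\<^bsub>P\<^esub> y) = q x"
    using q carr le K.le_iff_join qK by (simp add: surj_lattice_hom_def)
  then have "q (override_on z (x \<sqinter>\<^bsub>P\<^esub> y) S) = q ?u"
    using q carr by (intro override_on_eq) auto
  moreover have "override_on z (x \<sqinter>\<^bsub>P\<^esub> y) S = ?u \<sqinter>\<^bsub>P\<^esub> ?v"
  proof (rule P_eqI)
    fix t assume t: "t \<in> T"
    interpret lattice "L t" using t by (rule lattice_factor)
    have "z t \<sqinter>\<^bsub>L t\<^esub> z t = z t"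
      using carr t by (intro meet_eqI) (auto simp: P_component)
    then show "override_on z (x \<sqinter>\<^bsub>P\<^esub> y) S t = (?u \<sqinter>\<^bsub>P\<^esub> ?v) t"
      using carr t uv by (cases "t \<in> S") (simp_all add: meet_P)
  qed (use carr uv in \<open>simp_all add: override_on_P\<close>)
  ultimately have "q ?u = q ?u \<sqinter>\<^bsub>K\<^esub> q ?v"
    using q uv by (simp add: surj_lattice_hom_def)
  then show ?thesis
    using K.le_iff_join qK uv by simp
qed

text \<open>The order between values of \<open>q\<close> is tested separately on the coordinates in
  \<open>S\<close> and on the others. For the direction from right to left, \<open>x\<close> is
  changed into \<open>y\<close> in two stages through the mixed tuple
  \<open>override_on x y S\<close>.\<close>

lemma le_iff_override_on:
  assumes K: "lattice K" and q: "surj_lattice_hom P K q"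
    and carr: "x \<in> carrier P" "y \<in> carrier P" "b \<in> carrier P"
  shows "q x \<sqsubseteq>\<^bsub>K\<^esub> q y \<longleftrightarrow>
    q (override_on b x S) \<sqsubseteq>\<^bsub>K\<^esub> q (override_on b y S) \<and>
    q (override_on b x (- S)) \<sqsubseteq>\<^bsub>K\<^esub> q (override_on b y (- S))"
proof
  assume le: "q (override_on b x S) \<sqsubseteq>\<^bsub>K\<^esub> q (override_on b y S) \<and>
    q (override_on b x (- S)) \<sqsubseteq>\<^bsub>K\<^esub> q (override_on b y (- S))"
  interpret K: lattice K by fact
  have qK: "q w \<in> carrier K" if "w \<in> carrier P" for w
    using q that by (auto simp: surj_lattice_hom_def)
  \<comment> \<open>This lets \<open>override_on_mono\<close> exchange the base point
    \<open>b\<close> for an arbitrary \<open>z\<close>.\<close>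
  have absorb: "override_on z (override_on b w R) R = override_on z w R" for z w R
    by (simp add: override_on_def fun_eq_iff)
  have "q (override_on z x R) \<sqsubseteq>\<^bsub>K\<^esub> q (override_on z y R)"
    if "R = S \<or> R = - S" "z \<in> carrier P" for z R
    using override_on_mono[OF K q, of "override_on b x R" "override_on b y R" z R] that carr le
    by (auto simp: absorb override_on_P)
  \<comment> \<open>With base \<open>x\<close> the coordinates in \<open>S\<close> move from
    \<open>x\<close> to \<open>y\<close>; with base \<open>y\<close> the remaining ones do. The two
    inequalities meet in the mixed tuple.\<close>
  from this[of S x] this[of "- S" y]
  have "q (override_on x x S) \<sqsubseteq>\<^bsub>K\<^esub> q (override_on x y S)"
    "q (override_on y x (- S)) \<sqsubseteq>\<^bsub>K\<^esub> q (override_on y y (- S))"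
    using carr by simp_all
  moreover have "override_on x x S = x" "override_on y y (- S) = y"
    "override_on y x (- S) = override_on x y S"
    by (auto simp: override_on_def fun_eq_iff)
  ultimately have "q x \<sqsubseteq>\<^bsub>K\<^esub> q (override_on x y S)" "q (override_on x y S) \<sqsubseteq>\<^bsub>K\<^esub> q y"
    by simp_all
  then show "q x \<sqsubseteq>\<^bsub>K\<^esub> q y"
    using K.le_trans qK carr by (simp add: override_on_P)
qed (use assms in \<open>auto intro: override_on_mono\<close>)

text \<open>Since \<open>b\<close> is idempotent in each coordinate, overriding \<open>b\<close>
  commutes with join and meet. The slice through \<open>b\<close> is thus closed under both, and so
  is its image under \<open>q\<close>.\<close>

lemma lattice_slice:
  assumes K: "lattice K" and q: "surj_lattice_hom P K q" and b: "b \<in> carrier P"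
  shows "lattice \<lparr>carrier = (\<lambda>x. q (override_on b x S)) ` carrier P, eq = (=), le = le K\<rparr>"
    (is "lattice \<lparr>carrier = ?c ` _, eq = _, le = _\<rparr>")
proof -
  interpret K: lattice K by fact
  have bb: "b t \<squnion>\<^bsub>L t\<^esub> b t = b t" "b t \<sqinter>\<^bsub>L t\<^esub> b t = b t" if t: "t \<in> T" for t
  proof -
    interpret lattice "L t" using t by (rule lattice_factor)
    show "b t \<squnion>\<^bsub>L t\<^esub> b t = b t" "b t \<sqinter>\<^bsub>L t\<^esub> b t = b t"
      using b t by (auto simp: P_component intro!: join_eqI meet_eqI)
  qed
  have join: "override_on b x S \<squnion>\<^bsub>P\<^esub> override_on b y S = override_on b (x \<squnion>\<^bsub>P\<^esub> y) S"
    and meet: "override_on b x S \<sqinter>\<^bsub>P\<^esub> override_on b y S = override_on b (x \<sqinter>\<^bsub>P\<^esub> y) S"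
    if xy: "x \<in> carrier P" "y \<in> carrier P" for x y
  proof -
    have u: "override_on b x S \<in> carrier P" "override_on b y S \<in> carrier P"
      using xy b by (simp_all add: override_on_P)
    have "(override_on b x S \<squnion>\<^bsub>P\<^esub> override_on b y S) t = override_on b (x \<squnion>\<^bsub>P\<^esub> y) S t"
      "(override_on b x S \<sqinter>\<^bsub>P\<^esub> override_on b y S) t = override_on b (x \<sqinter>\<^bsub>P\<^esub> y) S t"
      if "t \<in> T" for t
      using that unfolding join_P[OF u] meet_P[OF u] join_P[OF xy] meet_P[OF xy]
      by (simp_all add: override_on_def bb)
    then show "override_on b x S \<squnion>\<^bsub>P\<^esub> override_on b y S = override_on b (x \<squnion>\<^bsub>P\<^esub> y) S"
      "override_on b x S \<sqinter>\<^bsub>P\<^esub> override_on b y S = override_on b (x \<sqinter>\<^bsub>P\<^esub> y) S"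
      using u xy b by (auto intro!: P_eqI simp: override_on_P)
  qed
  show ?thesis
  proof (rule K.sublattice)
    show "?c ` carrier P \<subseteq> carrier K"
      using q b by (auto simp: surj_lattice_hom_def override_on_P)
  next
    fix u v assume "u \<in> ?c ` carrier P" "v \<in> ?c ` carrier P"
    then obtain x y where xy: "x \<in> carrier P" "y \<in> carrier P" "u = ?c x" "v = ?c y" by auto
    then have "u \<squnion>\<^bsub>K\<^esub> v = ?c (x \<squnion>\<^bsub>P\<^esub> y)" "u \<sqinter>\<^bsub>K\<^esub> v = ?c (x \<sqinter>\<^bsub>P\<^esub> y)"
      using q b by (simp_all add: surj_lattice_hom_def override_on_P flip: join meet)
    then show "u \<squnion>\<^bsub>K\<^esub> v \<in> ?c ` carrier P" "u \<sqinter>\<^bsub>K\<^esub> v \<in> ?c ` carrier P"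
      using xy by auto
  qed
qed

section \<open>Homomorphisms onto irreducible lattices depend on one coordinate\<close>

text \<open>By \<open>override_on_eq\<close>, constancy on the slice through \<open>b\<close>
  carries over to the parallel slice through any \<open>x\<close>, and a tuple agreeing with
  \<open>x\<close> off \<open>S\<close> lies in that slice.\<close>

lemma determined_by_complement:
  assumes q: "surj_lattice_hom P K q" and b: "b \<in> carrier P"
    and const: "(\<lambda>x. q (override_on b x S)) ` carrier P = {c}"
  shows "determined_by (carrier P) (- S) q"
  unfolding determined_by_def
proof (intro ballI impI)
  fix x y assume xy: "x \<in> carrier P" "y \<in> carrier P" and agree: "\<forall>t\<in>- S. x t = y t"
  have "q (override_on b x S) = q (override_on b y S)"
    using const xy by (metis imageI singletonD)
  then have "q (override_on x (override_on b x S) S) = q (override_on x (override_on b y S) S)"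
    using b xy by (intro override_on_eq[OF q override_on_P override_on_P])
  moreover have "override_on x (override_on b x S) S = x" "override_on x (override_on b y S) S = y"
    using agree by (auto simp: override_on_def fun_eq_iff)
  ultimately show "q x = q y" by simp
qed

text \<open>If both alternatives fail, the images of the two complementary slices are nontrivial,
  and \<open>K\<close> is isomorphic to their product, contradicting irreducibility.\<close>

lemma determined_by_or_complement:
  assumes K: "irreducible_lattice K" and q: "surj_lattice_hom P K q"
  shows "determined_by (carrier P) S q \<or> determined_by (carrier P) (- S) q"
proof (rule ccontr)
  assume not_det: "\<not> ?thesis"
  have K': "lattice K" and "carrier K \<noteq> {}"
    using K by (auto simp: irreducible_lattice_def nontrivial_lattice_def)
  interpret K: lattice K by fact
  have surj: "q ` carrier P = carrier K"
    using q by (simp add: surj_lattice_hom_def)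
  then obtain b where b: "b \<in> carrier P" using \<open>carrier K \<noteq> {}\<close> by auto
  define c where "c S x = q (override_on b x S)" for S x
  define A :: "'t set \<Rightarrow> 'b gorder" where "A S = \<lparr>carrier = c S ` carrier P, eq = (=), le = le K\<rparr>" for S
  \<comment> \<open>A singleton image would make \<open>q\<close> constant on the slice over
    \<open>S\<close>, hence determined by \<open>- S\<close>.\<close>
  have A: "nontrivial_lattice (A S)" if "\<not> determined_by (carrier P) (- S) q" for S
    using lattice_slice[OF K' q b, of S] determined_by_complement[OF q b, of S] that b
    by (auto simp: nontrivial_lattice_def A_def c_def[abs_def])
  have nontriv: "nontrivial_lattice (A S)" "nontrivial_lattice (A (- S))"
    using A[of S] A[of "- S"] not_det by auto
  then have po: "partial_order (A S)" "partial_order (A (- S))"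
    by (simp_all add: nontrivial_lattice_def lattice_def upper_semilattice_def)
  \<comment> \<open>An arbitrary choice of preimages; by \<open>override_on_eq\<close> the slice
    values \<open>c R (g k)\<close> do not depend on it.\<close>
  define g where "g = inv_into (carrier P) q"
  have g: "g k \<in> carrier P" "q (g k) = k" if "k \<in> carrier K" for k
    using that surj by (auto simp: g_def inv_into_into f_inv_into_f)
  define f where "f k = (c S (g k), c (- S) (g k))" for k
  have le: "fst (f k) \<sqsubseteq>\<^bsub>K\<^esub> fst (f l) \<and> snd (f k) \<sqsubseteq>\<^bsub>K\<^esub> snd (f l) \<longleftrightarrow> k \<sqsubseteq>\<^bsub>K\<^esub> l"
    if "k \<in> carrier K" "l \<in> carrier K" for k l
    using le_iff_override_on[OF K' q g(1)[OF that(1)] g(1)[OF that(2)] b, of S] g(2) that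
    by (simp add: f_def c_def)
  have "inj_on f (carrier K)"
    by (rule inj_onI) (metis K.le_antisym K.le_refl le)
  moreover have "f ` carrier K = carrier (A S) \<times> carrier (A (- S))"
  proof (intro equalityI subsetI)
    fix p assume "p \<in> carrier (A S) \<times> carrier (A (- S))"
    then obtain x y where xy: "x \<in> carrier P" "y \<in> carrier P" "p = (c S x, c (- S) y)"
      by (auto simp: A_def)
    \<comment> \<open>Taking \<open>x\<close> on \<open>S\<close> and \<open>y\<close> off
      \<open>S\<close> realises both prescribed slice values at once.\<close>
    define w where "w = override_on y x S"
    have w: "w \<in> carrier P" "q w \<in> carrier K"
      using xy surj by (auto simp: w_def override_on_P)
    have "c R (g (q w)) = c R w" for R
      unfolding c_def using q w b g by (intro override_on_eq) auto
    moreover have "c S w = c S x" "c (- S) w = c (- S) y"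
      by (auto simp: c_def w_def override_on_def intro!: arg_cong[of _ _ q])
    ultimately have "f (q w) = p" by (simp add: f_def xy)
    with w show "p \<in> f ` carrier K" by auto
  qed (auto simp: f_def A_def g)
  ultimately have "order_iso K (binary_product (A S) (A (- S))) f"
    using le weak_partial_order_binary_product[OF po] K.weak_partial_order_axioms
    by (simp add: order_iso_def order_emb_def bij_betw_def binary_product_def) (simp add: A_def)
  with nontriv K show False unfolding irreducible_lattice_def by blast
qed

text \<open>If no single coordinate determines \<open>q\<close>, the dichotomy allows each
  coordinate to be ignored. Dropping the finitely many coordinates one by one makes \<open>q\<close>
  constant, but its image \<open>K\<close> has more than one element.\<close>

lemma determined_by_coordinate:
  assumes T: "finite T" and K: "irreducible_lattice K" and q: "surj_lattice_hom P K q"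
  shows "\<exists>s\<in>T. determined_by (carrier P) {s} q"
proof (rule ccontr)
  assume no: "\<not> ?thesis"
  have "determined_by (carrier P) (T - F) q" if "finite F" "F \<subseteq> T" for F
    using that
  proof (induction F rule: finite_induct)
    case empty
    then show ?case by (auto simp: determined_by_def dest: P_eqI)
  next
    case (insert s F)
    have F: "determined_by (carrier P) (T - F) q" and s: "determined_by (carrier P) (- {s}) q"
      using insert determined_by_or_complement[OF K q, of "{s}"] no by auto
    show ?case
      unfolding determined_by_def
    proof (intro ballI impI)
      fix x y assume xy: "x \<in> carrier P" "y \<in> carrier P" and agree: "\<forall>t\<in>T - insert s F. x t = y t"
      \<comment> \<open>This tuple differs from \<open>x\<close> at most at \<open>s\<close> and
        agrees with \<open>y\<close> on \<open>T - F\<close>.\<close>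
      have w: "override_on x y {s} \<in> carrier P" using xy by (rule override_on_P)
      have "q x = q (override_on x y {s})"
        using s xy(1) w by (rule determined_byD) simp
      also have "\<dots> = q y"
        using F w xy(2) by (rule determined_byD) (use agree in \<open>auto simp: override_on_def\<close>)
      finally show "q x = q y" .
    qed
  qed
  then have "determined_by (carrier P) (T - T) q" using T by blast
  then have const: "q x = q y" if "x \<in> carrier P" "y \<in> carrier P" for x y
    using that by (rule determined_byD) simp
  have surj: "q ` carrier P = carrier K"
    using q by (simp add: surj_lattice_hom_def)
  moreover have "carrier K \<noteq> {}"
    using K by (simp add: irreducible_lattice_def nontrivial_lattice_def)
  ultimately obtain b where b: "b \<in> carrier P" by auto
  have "q ` carrier P = (\<lambda>_. q b) ` carrier P"
    using b by (intro image_cong refl const)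
  also have "\<dots> = {q b}" using b by (rule image_constant)
  finally have "q ` carrier P = {q b}" .
  with surj K show False
    by (auto simp: irreducible_lattice_def nontrivial_lattice_def)
qed

section \<open>From an automorphism to a permutation and factor isomorphisms\<close>

text \<open>Stated for any automorphism, because it is applied both to the given one and to its
  inverse.\<close>

lemma component_determined_by:
  assumes "finite T" and irr: "\<And>t. t \<in> T \<Longrightarrow> irreducible_lattice (L t)"
    and ne: "carrier P \<noteq> {}" and f: "order_iso P P f"
  shows "\<exists>\<tau>. \<forall>t\<in>T. \<tau> t \<in> T \<and> determined_by (carrier P) {\<tau> t} (\<lambda>x. f x t)"
proof -
  have "\<exists>s\<in>T. determined_by (carrier P) {s} (\<lambda>x. f x t)" if t: "t \<in> T" for t
  proof (rule determined_by_coordinate)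
    show "surj_lattice_hom P (L t) (\<lambda>x. f x t)"
      using surj_lattice_hom_comp[OF surj_lattice_hom_order_iso[OF lattice_P lattice_P f]
          surj_lattice_hom_component[OF t ne]] by (simp add: comp_def)
  qed (use assms t in auto)
  then have "\<forall>t\<in>T. \<exists>s. s \<in> T \<and> determined_by (carrier P) {s} (\<lambda>x. f x t)"
    by (simp add: Bex_def)
  then show ?thesis by (rule bchoice)
qed

text \<open>If \<open>r\<close> were different from \<open>t\<close>, changing a tuple at
  \<open>t\<close> alone could not change its \<open>t\<close>-th component, so \<open>L t\<close>
  would be a singleton.\<close>

lemma determined_by_component_unique:
  assumes t: "t \<in> T" and irr: "irreducible_lattice (L t)" and ne: "carrier P \<noteq> {}"
    and det: "determined_by (carrier P) {r} (\<lambda>x. x t)"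
  shows "r = t"
proof (rule ccontr)
  assume "r \<noteq> t"
  obtain b where b: "b \<in> carrier P" using ne by auto
  have "a = b t" if "a \<in> carrier (L t)" for a
  proof -
    have "b(t := a) \<in> carrier P"
      using b that t by (auto simp: carrier_P PiE_iff extensional_def)
    then have "(b(t := a)) t = b t"
      using b by (rule determined_byD[OF det]) (simp add: \<open>r \<noteq> t\<close>)
    then show ?thesis by simp
  qed
  then have "carrier (L t) = {b t}" using P_component[OF b t] by blast
  then show False using irr unfolding irreducible_lattice_def nontrivial_lattice_def by blast
qed

text \<open>Component \<open>t\<close> of \<open>\<phi>\<close> depends on coordinate
  \<open>\<tau> t\<close> only, and component \<open>t\<close> of the inverse
  \<open>\<theta>\<close> on coordinate \<open>\<rho> t\<close> only. Component \<open>t\<close> of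
  either composite is the projection to \<open>t\<close>, so uniqueness of the determining
  coordinate makes \<open>\<tau>\<close> and \<open>\<rho>\<close> mutually inverse on
  \<open>T\<close>.\<close>

lemma order_automorphism_decompose:
  assumes fin: "finite T" and irr: "\<And>t. t \<in> T \<Longrightarrow> irreducible_lattice (L t)"
    and ne: "carrier P \<noteq> {}" and \<phi>: "order_iso P P \<phi>"
  shows "\<exists>\<sigma> \<psi>. \<sigma> permutes T \<and> (\<forall>t\<in>T. order_iso (L t) (L (inv \<sigma> t)) (\<psi> t)) \<and>
    (\<forall>x\<in>carrier P. \<phi> x = (\<lambda>t\<in>T. \<psi> (\<sigma> t) (x (\<sigma> t))))"
proof -
  define \<theta> where "\<theta> = inv_into (carrier P) \<phi>"
  have \<theta>: "order_iso P P \<theta>" unfolding \<theta>_def using \<phi> by (rule order_iso_inv)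
  have bij: "bij_betw \<phi> (carrier P) (carrier P)" using \<phi> by (simp add: order_iso_def)
  have carr: "\<phi> x \<in> carrier P" "\<theta> x \<in> carrier P" if "x \<in> carrier P" for x
    using that \<phi> \<theta> by (auto simp: order_iso_def bij_betw_def)
  have \<theta>\<phi>: "\<theta> (\<phi> x) = x" and \<phi>\<theta>: "\<phi> (\<theta> x) = x" if "x \<in> carrier P" for x
    using bij_betw_inv_into_left[OF bij that] bij_betw_inv_into_right[OF bij that]
    by (simp_all add: \<theta>_def)
  have le: "x \<sqsubseteq>\<^bsub>P\<^esub> y \<longleftrightarrow> \<phi> x \<sqsubseteq>\<^bsub>P\<^esub> \<phi> y" if "x \<in> carrier P" "y \<in> carrier P" for x y
    using that \<phi> by (simp add: order_iso_def order_emb_def)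
  obtain \<tau> where \<tau>: "\<And>t. t \<in> T \<Longrightarrow> \<tau> t \<in> T"
    and \<tau>_det: "\<And>t. t \<in> T \<Longrightarrow> determined_by (carrier P) {\<tau> t} (\<lambda>x. \<phi> x t)"
    using component_determined_by[OF fin irr ne \<phi>] by blast
  obtain \<rho> where \<rho>: "\<And>t. t \<in> T \<Longrightarrow> \<rho> t \<in> T"
    and \<rho>_det: "\<And>t. t \<in> T \<Longrightarrow> determined_by (carrier P) {\<rho> t} (\<lambda>x. \<theta> x t)"
    using component_determined_by[OF fin irr ne \<theta>] by blast
  have \<rho>\<tau>: "\<rho> (\<tau> t) = t" if t: "t \<in> T" for t
  proof (rule determined_by_component_unique[OF t irr[OF t] ne])
    show "determined_by (carrier P) {\<rho> (\<tau> t)} (\<lambda>x. x t)"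
      unfolding determined_by_def
    proof (intro ballI impI)
      fix x y assume xy: "x \<in> carrier P" "y \<in> carrier P" and "\<forall>r\<in>{\<rho> (\<tau> t)}. x r = y r"
      then have "\<theta> x (\<tau> t) = \<theta> y (\<tau> t)"
        by (intro determined_byD[OF \<rho>_det[OF \<tau>[OF t]]]) auto
      then have "\<phi> (\<theta> x) t = \<phi> (\<theta> y) t"
        using xy by (intro determined_byD[OF \<tau>_det[OF t]]) (auto simp: carr)
      then show "x t = y t" using xy by (simp add: \<phi>\<theta>)
    qed
  qed
  have \<tau>\<rho>: "\<tau> (\<rho> t) = t" if t: "t \<in> T" for t
  proof (rule determined_by_component_unique[OF t irr[OF t] ne])
    show "determined_by (carrier P) {\<tau> (\<rho> t)} (\<lambda>x. x t)"
      unfolding determined_by_def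
    proof (intro ballI impI)
      fix x y assume xy: "x \<in> carrier P" "y \<in> carrier P" and "\<forall>r\<in>{\<tau> (\<rho> t)}. x r = y r"
      then have "\<phi> x (\<rho> t) = \<phi> y (\<rho> t)"
        by (intro determined_byD[OF \<tau>_det[OF \<rho>[OF t]]]) auto
      then have "\<theta> (\<phi> x) t = \<theta> (\<phi> y) t"
        using xy by (intro determined_byD[OF \<rho>_det[OF t]]) (auto simp: carr)
      then show "x t = y t" using xy by (simp add: \<theta>\<phi>)
    qed
  qed
  \<comment> \<open>Outside \<open>T\<close> the identity is used, as \<open>permutes\<close>
    demands.\<close>
  define \<sigma> where "\<sigma> t = (if t \<in> T then \<tau> t else t)" for t
  have "bij_betw \<sigma> T T"
    by (rule bij_betwI[where g = \<rho>]) (auto simp: \<sigma>_def \<tau> \<rho> \<tau>\<rho> \<rho>\<tau>)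
  then have \<sigma>: "\<sigma> permutes T"
    by (rule bij_imp_permutes) (simp add: \<sigma>_def)
  have inv_\<sigma>: "inv \<sigma> s = \<rho> s" if "s \<in> T" for s
    using that by (simp add: permutes_inv_eq[OF \<sigma>] \<sigma>_def \<rho> \<tau>\<rho>)
  obtain b where b: "b \<in> carrier P" using ne by auto
  have upd: "b(s := a) \<in> carrier P" if "s \<in> T" "a \<in> carrier (L s)" for s a
    using b that by (auto simp: carrier_P PiE_iff extensional_def)
  \<comment> \<open>Coordinate \<open>s\<close> influences only component \<open>\<rho> s\<close>,
    so \<open>\<phi>\<close> is read off there along the line through \<open>b\<close> in direction
    \<open>s\<close>.\<close>
  define \<psi> where "\<psi> s a = \<phi> (b(s := a)) (\<rho> s)" for s a
  have \<phi>_eq: "\<phi> x t = \<psi> (\<tau> t) (x (\<tau> t))" if x: "x \<in> carrier P" and t: "t \<in> T" for x t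
    unfolding \<psi>_def \<rho>\<tau>[OF t]
    using x upd[OF \<tau>[OF t] P_component[OF x \<tau>[OF t]]]
    by (rule determined_byD[OF \<tau>_det[OF t]]) simp
  have "order_iso (L s) (L (\<rho> s)) (\<psi> s)" if s: "s \<in> T" for s
  proof -
    interpret Ls: lattice "L s" using s by (rule lattice_factor)
    interpret Lr: lattice "L (\<rho> s)" using \<rho>[OF s] by (rule lattice_factor)
    have mono: "\<psi> s a \<sqsubseteq>\<^bsub>L (\<rho> s)\<^esub> \<psi> s a' \<longleftrightarrow> a \<sqsubseteq>\<^bsub>L s\<^esub> a'"
      if a: "a \<in> carrier (L s)" "a' \<in> carrier (L s)" for a a'
    proof -
      note u = upd[OF s a(1)] upd[OF s a(2)]
      have refl: "w t \<sqsubseteq>\<^bsub>L t\<^esub> w t" if "w \<in> carrier P" "t \<in> T" for w t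
        using P.le_refl[OF that(1)] that(2) by (simp add: le_P)
      have "a \<sqsubseteq>\<^bsub>L s\<^esub> a' \<longleftrightarrow> b(s := a) \<sqsubseteq>\<^bsub>P\<^esub> b(s := a')"
        using s refl[OF b] by (auto simp: le_P)
      also have "\<dots> \<longleftrightarrow> (\<forall>t\<in>T. \<phi> (b(s := a)) t \<sqsubseteq>\<^bsub>L t\<^esub> \<phi> (b(s := a')) t)"
        using le[OF u] by (simp add: le_P)
      also have "\<dots> \<longleftrightarrow> \<psi> s a \<sqsubseteq>\<^bsub>L (\<rho> s)\<^esub> \<psi> s a'"
      proof
        assume *: "\<psi> s a \<sqsubseteq>\<^bsub>L (\<rho> s)\<^esub> \<psi> s a'"
        show "\<forall>t\<in>T. \<phi> (b(s := a)) t \<sqsubseteq>\<^bsub>L t\<^esub> \<phi> (b(s := a')) t"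
        proof
          fix t assume t: "t \<in> T"
          show "\<phi> (b(s := a)) t \<sqsubseteq>\<^bsub>L t\<^esub> \<phi> (b(s := a')) t"
          proof (cases "t = \<rho> s")
            case True
            with * show ?thesis by (simp add: \<psi>_def)
          next
            case False
            \<comment> \<open>Otherwise \<open>t = \<rho> (\<tau> t) = \<rho> s\<close>. So every
              component other than \<open>\<rho> s\<close> is the same for both tuples.\<close>
            then have "\<tau> t \<noteq> s" using \<rho>\<tau>[OF t] by auto
            then have "\<phi> (b(s := a)) t = \<phi> (b(s := a')) t"
              by (intro determined_byD[OF \<tau>_det[OF t] u]) auto
            then show ?thesis using refl carr u t by simp
          qed
        qed
      qed (use \<rho>[OF s] in \<open>simp add: \<psi>_def\<close>)
      finally show ?thesis ..
    qed
    have "inj_on (\<psi> s) (carrier (L s))"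
      by (rule inj_onI) (metis mono Ls.le_antisym Ls.le_refl)
    moreover have "\<psi> s ` carrier (L s) = carrier (L (\<rho> s))"
    proof (intro equalityI subsetI)
      fix c assume "c \<in> carrier (L (\<rho> s))"
      \<comment> \<open>A tuple with \<open>c\<close> in place \<open>\<rho> s\<close> is pulled
        back along \<open>\<theta>\<close>; coordinate \<open>s\<close> of the result is the
        preimage of \<open>c\<close>.\<close>
      then have "b(\<rho> s := c) \<in> carrier P" using \<rho>[OF s] by (intro upd)
      then have "c = \<phi> (\<theta> (b(\<rho> s := c))) (\<rho> s)" "\<theta> (b(\<rho> s := c)) \<in> carrier P"
        by (simp_all add: \<phi>\<theta> carr)
      then have "c = \<psi> s (\<theta> (b(\<rho> s := c)) s)" "\<theta> (b(\<rho> s := c)) s \<in> carrier (L s)"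
        using \<phi>_eq[OF _ \<rho>[OF s]] s by (simp_all add: \<tau>\<rho> P_component)
      then show "c \<in> \<psi> s ` carrier (L s)" by (rule image_eqI)
    qed (use s \<rho> upd carr in \<open>auto simp: \<psi>_def P_component\<close>)
    ultimately show ?thesis
      using mono Ls.weak_partial_order_axioms Lr.weak_partial_order_axioms
      by (simp add: order_iso_def order_emb_def bij_betw_def)
  qed
  moreover have "\<phi> x = (\<lambda>t\<in>T. \<psi> (\<sigma> t) (x (\<sigma> t)))" if "x \<in> carrier P" for x
  proof (rule ext)
    fix t show "\<phi> x t = (\<lambda>t\<in>T. \<psi> (\<sigma> t) (x (\<sigma> t))) t"
    proof (cases "t \<in> T")
      case True
      then show ?thesis by (simp add: \<phi>_eq[OF that] \<sigma>_def)
    next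
      case False
      then show ?thesis using PiE_arb[OF carr(1)[OF that, unfolded carrier_P] False] by simp
    qed
  qed
  ultimately have "(\<forall>t\<in>T. order_iso (L t) (L (inv \<sigma> t)) (\<psi> t)) \<and>
      (\<forall>x\<in>carrier P. \<phi> x = (\<lambda>t\<in>T. \<psi> (\<sigma> t) (x (\<sigma> t))))"
    by (auto simp only: inv_\<sigma>)
  with \<sigma> show ?thesis by blast
qed

section \<open>The converse direction and the equivalence\<close>

text \<open>Comparing images at \<open>t\<close> amounts to comparing arguments at
  \<open>\<sigma> t\<close>, and \<open>\<sigma> t\<close> runs through all of \<open>T\<close>.
  This gives the order embedding and hence injectivity; surjectivity comes from explicit
  preimages.\<close>

lemma order_automorphism_permuted:
  assumes \<sigma>: "\<sigma> permutes T"
    and \<psi>: "\<And>t. t \<in> T \<Longrightarrow> order_iso (L t) (L (inv \<sigma> t)) (\<psi> t)"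
    and eq: "\<And>x. x \<in> carrier P \<Longrightarrow> \<phi> x = (\<lambda>t\<in>T. \<psi> (\<sigma> t) (x (\<sigma> t)))"
  shows "order_iso P P \<phi>"
proof -
  have in_T: "\<sigma> t \<in> T" "inv \<sigma> t \<in> T" if "t \<in> T" for t
    using that permutes_in_image[OF \<sigma>] permutes_in_image[OF permutes_inv[OF \<sigma>]] by auto
  note inverses = permutes_inverses[OF \<sigma>]
  \<comment> \<open>The target is \<open>L t\<close> because
    \<open>inv \<sigma> (\<sigma> t) = t\<close>.\<close>
  have bij: "bij_betw (\<psi> (\<sigma> t)) (carrier (L (\<sigma> t))) (carrier (L t))" if "t \<in> T" for t
    using \<psi>[of "\<sigma> t"] that by (simp add: order_iso_def in_T inverses)
  have component: "\<phi> x t = \<psi> (\<sigma> t) (x (\<sigma> t))" if "x \<in> carrier P" "t \<in> T" for x t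
    using eq that by simp
  have carr: "\<phi> x \<in> carrier P" if "x \<in> carrier P" for x
    unfolding eq[OF that]
    using that bij_betwE[OF bij] by (intro restrict_in_P) (auto simp: P_component in_T)
  have le: "\<phi> x \<sqsubseteq>\<^bsub>P\<^esub> \<phi> y \<longleftrightarrow> x \<sqsubseteq>\<^bsub>P\<^esub> y" if xy: "x \<in> carrier P" "y \<in> carrier P" for x y
  proof -
    have "\<phi> x t \<sqsubseteq>\<^bsub>L t\<^esub> \<phi> y t \<longleftrightarrow> x (\<sigma> t) \<sqsubseteq>\<^bsub>L (\<sigma> t)\<^esub> y (\<sigma> t)" if "t \<in> T" for t
      using \<psi>[of "\<sigma> t"] that xy
      by (simp add: component order_iso_def order_emb_def in_T inverses P_component)
    then have "\<phi> x \<sqsubseteq>\<^bsub>P\<^esub> \<phi> y \<longleftrightarrow> (\<forall>t\<in>T. x (\<sigma> t) \<sqsubseteq>\<^bsub>L (\<sigma> t)\<^esub> y (\<sigma> t))"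
      by (simp add: le_P)
    also have "\<dots> \<longleftrightarrow> (\<forall>s\<in>\<sigma> ` T. x s \<sqsubseteq>\<^bsub>L s\<^esub> y s)" by blast
    finally show ?thesis by (simp add: le_P permutes_image[OF \<sigma>])
  qed
  have "inj_on \<phi> (carrier P)"
    by (rule inj_onI) (metis le P.le_antisym P.le_refl)
  moreover have "y \<in> \<phi> ` carrier P" if y: "y \<in> carrier P" for y
  proof -
    \<comment> \<open>Coordinate \<open>s\<close> of the argument reappears in component
      \<open>inv \<sigma> s\<close> of the image, so it is recovered from there.\<close>
    define x where "x = (\<lambda>s\<in>T. inv_into (carrier (L s)) (\<psi> s) (y (inv \<sigma> s)))"
    have x: "x \<in> carrier P"
      unfolding x_def
    proof (rule restrict_in_P)
      fix s assume s: "s \<in> T"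
      then show "inv_into (carrier (L s)) (\<psi> s) (y (inv \<sigma> s)) \<in> carrier (L s)"
        using bij_betwE[OF bij_betw_inv_into[OF bij[OF in_T(2)[OF s]]]] P_component[OF y in_T(2)[OF s]]
        by (simp add: inverses)
    qed
    have "\<phi> x t = y t" if "t \<in> T" for t
      using that x bij_betw_inv_into_right[OF bij[OF that] P_component[OF y that]]
      by (simp add: component in_T inverses) (simp add: x_def in_T inverses)
    then have "\<phi> x = y" using x y carr by (intro P_eqI) auto
    with x show ?thesis by auto
  qed
  ultimately have "bij_betw \<phi> (carrier P) (carrier P)"
    using carr by (auto simp: bij_betw_def)
  then show ?thesis
    using le P.weak_partial_order_axioms by (simp add: order_iso_def order_emb_def)
qed

end

theorem theorem4p1:
  fixes T :: "'t set"
    and L :: "'t \<Rightarrow> 'a gorder"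
    and \<phi> :: "('t \<Rightarrow> 'a) \<Rightarrow> ('t \<Rightarrow> 'a)"
  assumes "finite T"
    and "\<And>t. t \<in> T \<Longrightarrow> irreducible_lattice (L t)"
    and "\<phi> \<in> carrier (direct_product T L) \<rightarrow> carrier (direct_product T L)"
  shows "order_automorphism (direct_product T L) \<phi> \<longleftrightarrow>
    (\<exists>(\<sigma> :: 't \<Rightarrow> 't) (\<psi> :: 't \<Rightarrow> 'a \<Rightarrow> 'a).
        \<sigma> permutes T \<and>
        (\<forall>t\<in>T. order_iso (L t) (L (inv \<sigma> t)) (\<psi> t)) \<and>
        (\<forall>x\<in>carrier (direct_product T L).
            \<phi> x = (\<lambda>t\<in>T. \<psi> (\<sigma> t) (x (\<sigma> t)))))"
proof -
  interpret lattice_family T L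
    using assms(2) by (simp add: lattice_family_def irreducible_lattice_def nontrivial_lattice_def)
  \<comment> \<open>Nonempty factors give a nonempty product; for empty \<open>T\<close> it consists
    of the single everywhere \<open>undefined\<close> function.\<close>
  have "carrier P \<noteq> {}"
    using assms(2)
    by (auto simp: carrier_P PiE_eq_empty_iff irreducible_lattice_def nontrivial_lattice_def)
  then show ?thesis
    using order_automorphism_decompose[OF assms(1,2)] order_automorphism_permuted by blast
qed

end
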